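(* Let $m\ge2$ be an integer, $M=(m+1)(m+2)/2$, and let $K>0$ be a constant such that the Lebesgue constants of the Padua points satisfy $\mathscr{L}_k\big(X^{\mathrm{Pad}}_{(k+1)(k+2)/2}\big)\le K(\ln k)^2$ for all integers $k\ge2$. Let $0<\alpha<1$ and let $\mathcal{T}_N$ be a triangulation of $\Omega=[-1,1]^2$ whose maximum edge length $h_{\max}$ satisfies $$h_{\max}<\min\left\{\frac{\alpha}{2K(m\ln m)^2},\ \sqrt2\left(1-\cos\left(\frac{\pi}{m+1}\right)\right)\right\}.$$ Then the Lebesgue constant of the Padua triangles is bounded by $$\mathscr{L}_m\left(\mathcal{T}_M^{\mathrm{Pad}}\right)\le\frac{K}{1-\alpha}(\ln m)^2 .$$
   Context: $\mathbb{P}_m(\mathbb{R}^2)$ is the space of real bivariate polynomials of total degree at most $m$; its dimension is $M=(m+1)(m+2)/2$. Triangulation: $\mathcal{T}_N=\{t_1,\dots,t_N\}$ is a finite ordered list of closed non-degenerate triangles with $\Omega=\bigcup_{i=1}^Nt_i$ and $|t_i\cap t_j|=0$ (Lebesgue measure zero) for $i\ne j$; $h_{\max}$ is the maximum Euclidean length of an edge of a triangle of $\mathcal{T}_N$. Padua points: $$X_M^{\mathrm{Pad}}=\left\{\left((-1)^{i+j}\cos\frac{\pi j}{m+1},\,(-1)^{i+j}\cos\frac{i\pi}{m}\right): i,j\in\mathbb{Z}_{\ge 0},\ 0\le i+j\le m\right\}\subset[-1,1]^2 .$$ It is known that $X_M^{\mathrm{Pad}}$ has $M$ elements and is unisolvent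 for polynomial interpolation in $\mathbb{P}_m(\mathbb{R}^2)$. Its Lebesgue constant is $\mathscr{L}_m(X_M^{\mathrm{Pad}})=\sup_{\xi\in\Omega}\sum_{\boldsymbol x\in X_M^{\mathrm{Pad}}}|\ell_{\boldsymbol x}(\xi)|$, where $\ell_{\boldsymbol x}\in\mathbb{P}_m(\mathbb{R}^2)$ are the Lagrange polynomials with $\ell_{\boldsymbol x}(\boldsymbol y)=\delta_{\boldsymbol x,\boldsymbol y}$ for $\boldsymbol x,\boldsymbol y\in X_M^{\mathrm{Pad}}$. It is known (Bos, Caliari, De Marchi, Vianello, Xu) that a constant $K$ as in the claim exists. Padua triangles: each Padua point is attributed to the first triangle in the ordered list $\mathcal{T}_N$ that contains it; $\mathcal{T}_M^{\mathrm{Pad}}$ is the set of triangles obtained in this way. Under the hypothesis on $h_{\max}$ it consists of $M$ triangles and is unisolvent, i.e. the only $p\in\mathbb{P}_m(\mathbb{R}^2)$ with $\int_tp=0$ for all $t\in\mathcal{T}_M^{\mathrm{Pad}}$ is $p=0$. Lebesgue constant of a unisolvent set $\mathcal{T}_M=\{t_1,\dots,t_M\}$ of triangles in $\Omega$: let $\ell_{t_1},\dots,\ell_{t_M}\in\mathbb{P}_m(\mathbb{R}^2)$ be the Lagrange basis determined by $\frac1{|t_i|}\int_{t_i}\ell_{t_j}(x,y)\,\mathrm{d}x\,\mathrm{d}y=\delta_{i,j}$. Then $$\mathscr{L}_m(\mathcal{T}_M)=\sup_{t\subset\Omega}\frac1{|t|}\sum_{i=1}^M\left|\int_t\ell_{t_i}(x,y)\,\mathrm{d}x\,\mathrm{d}y\right|=\sup_{\xi\in\Omega}\sum_{i=1}^M|\ell_{t_i}(\xi)|,$$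 where $t$ ranges over all (non-degenerate) triangles contained in $\Omega$. *)

theory Defs
  imports "HOL-Analysis.Analysis"
begin

type_synonym plane = "real \<times> real"

text \<open>Bivariate polynomials are identified with the functions they induce on the plane
  (a faithful identification, as the reals are infinite); the degree bound is on the total degree.\<close>

definition bipoly :: "nat \<Rightarrow> (plane \<Rightarrow> real) set" where
  "bipoly m = {p. \<exists>c :: nat \<Rightarrow> nat \<Rightarrow> real.
     p = (\<lambda>(x, y). \<Sum>(i, j) \<in> {(i, j). i + j \<le> m}. c i j * x ^ i * y ^ j)}"

definition bipoly_dim :: "nat \<Rightarrow> nat" where
  "bipoly_dim m = (m + 1) * (m + 2) div 2"

definition square :: "plane set" where
  "square = {-1..1} \<times> {-1..1}"

definition triangle :: "plane set \<Rightarrow> bool" where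
  "triangle t \<longleftrightarrow> 2 simplex t"

definition triangulation_of :: "plane set \<Rightarrow> plane set list \<Rightarrow> bool" where
  "triangulation_of \<Omega> T \<longleftrightarrow>
     (\<forall>t \<in> set T. triangle t) \<and> \<Union> (set T) = \<Omega> \<and>
     (\<forall>i < length T. \<forall>j < length T. i \<noteq> j \<longrightarrow> emeasure lborel (T ! i \<inter> T ! j) = 0)"

text \<open>The vertices of a triangle are its extreme points, and any two distinct vertices span
  an edge; \<open>dist\<close> on pairs is the Euclidean distance.\<close>

definition h_max :: "plane set list \<Rightarrow> real" where
  "h_max T = Max {dist a b | a b t.
     t \<in> set T \<and> a extreme_point_of t \<and> b extreme_point_of t \<and> a \<noteq> b}"

definition padua_points :: "nat \<Rightarrow> plane set" where
  "padua_points m =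
     {((-1) ^ (i + j) * cos (pi * real j / real (m + 1)),
       (-1) ^ (i + j) * cos (real i * pi / real m)) | i j. i + j \<le> m}"

definition first_triangle :: "plane set list \<Rightarrow> plane \<Rightarrow> plane set" where
  "first_triangle T x = T ! (LEAST i. i < length T \<and> x \<in> T ! i)"

definition padua_triangles :: "nat \<Rightarrow> plane set list \<Rightarrow> plane set set" where
  "padua_triangles m T = first_triangle T ` padua_points m"

definition unisolvent_points :: "nat \<Rightarrow> plane set \<Rightarrow> bool" where
  "unisolvent_points m X \<longleftrightarrow> card X = bipoly_dim m \<and>
     (\<forall>p \<in> bipoly m. (\<forall>x \<in> X. p x = 0) \<longrightarrow> p = (\<lambda>_. 0))"

definition lagrange_point :: "nat \<Rightarrow> plane set \<Rightarrow> plane \<Rightarrow> plane \<Rightarrow> real" where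
  "lagrange_point m X x =
     (THE p. p \<in> bipoly m \<and> (\<forall>y \<in> X. p y = (if x = y then 1 else 0)))"

text \<open>Lebesgue constants are only meaningful for unisolvent sets.  They are extended-real valued,
  with the convention that the constant of a set that is not unisolvent is \<open>\<infinity>\<close>; a finite bound
  thus includes the well-definedness of the Lagrange basis.\<close>

definition lebesgue_const_points :: "plane set \<Rightarrow> nat \<Rightarrow> plane set \<Rightarrow> ereal" where
  "lebesgue_const_points \<Omega> m X =
     (if unisolvent_points m X
      then (SUP \<xi> \<in> \<Omega>. ereal (\<Sum>x \<in> X. \<bar>lagrange_point m X x \<xi>\<bar>))
      else \<infinity>)"

definition unisolvent_triangles :: "nat \<Rightarrow> plane set set \<Rightarrow> bool" where
  "unisolvent_triangles m S \<longleftrightarrow> card S = bipoly_dim m \<and>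
     (\<forall>p \<in> bipoly m. (\<forall>t \<in> S. (LINT z:t|lborel. p z) = 0) \<longrightarrow> p = (\<lambda>_. 0))"

definition lagrange_triangle :: "nat \<Rightarrow> plane set set \<Rightarrow> plane set \<Rightarrow> plane \<Rightarrow> real" where
  "lagrange_triangle m S s =
     (THE p. p \<in> bipoly m \<and>
        (\<forall>t \<in> S. 1 / measure lborel t * (LINT z:t|lborel. p z) = (if s = t then 1 else 0)))"

definition lebesgue_const_triangles :: "plane set \<Rightarrow> nat \<Rightarrow> plane set set \<Rightarrow> ereal" where
  "lebesgue_const_triangles \<Omega> m S =
     (if unisolvent_triangles m S
      then (SUP t \<in> {t. triangle t \<and> t \<subseteq> \<Omega>}.
              ereal (1 / measure lborel t *
                     (\<Sum>s \<in> S. \<bar>LINT z:t|lborel. lagrange_triangle m S s z\<bar>)))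
      else \<infinity>)"

end

theory Submission
  imports Defs "HOL-Computational_Algebra.Polynomial"
begin

text \<open>By Markov's inequality along horizontal and vertical segments, a polynomial of degree \<open>m\<close>
  bounded by \<open>B\<close> on the square is Lipschitz there with constant \<open>2 m\<^sup>2 B\<close>, so its average over a triangle
  of diameter at most \<open>h\<close> differs from its value at any point of the triangle by at most
  \<open>2 m\<^sup>2 h B\<close>. Since the points have Lebesgue constant at most \<open>L = K (ln m)\<^sup>2\<close> and
  \<open>2 m\<^sup>2 h L \<le> \<alpha>\<close>, a polynomial whose averages over the Padua triangles are bounded by \<open>A\<close>
  is bounded by \<open>L A / (1 - \<alpha>)\<close>. With \<open>A = 0\<close> this gives unisolvence, with \<open>A = 1\<close> the estimate.

  Markov's inequality is derived from Bernstein's inequality, and the latter from M. Riesz'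
  interpolation formula for the derivative of a trigonometric polynomial.\<close>

section \<open>Trigonometric polynomials and Markov's inequality\<close>

text \<open>The span of cos (j t) and sin (j t) with j \<le> n is generated inductively, so that a
  claim linear in \<open>f\<close>, such as the formula of Riesz, is checked on the
  generators.\<close>

inductive trig_poly :: "nat \<Rightarrow> (real \<Rightarrow> real) \<Rightarrow> bool" for n where
  cos: "j \<le> n \<Longrightarrow> trig_poly n (\<lambda>t. cos (real j * t))"
| sin: "j \<le> n \<Longrightarrow> trig_poly n (\<lambda>t. sin (real j * t))"
| add: "trig_poly n f \<Longrightarrow> trig_poly n g \<Longrightarrow> trig_poly n (\<lambda>t. f t + g t)"
| scale: "trig_poly n f \<Longrightarrow> trig_poly n (\<lambda>t. c * f t)"

lemma trig_poly_mono:
  assumes "trig_poly n f" "n \<le> k" shows "trig_poly k f"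
  using assms(1) by induction (use assms(2) in \<open>auto intro: trig_poly.intros\<close>)

lemma trig_poly_zero: "trig_poly n (\<lambda>t. 0)"
  using trig_poly.scale[OF trig_poly.cos[of 0], of n 0] by simp

lemma trig_poly_sum:
  assumes "\<And>i. i \<in> I \<Longrightarrow> trig_poly n (f i)"
  shows "trig_poly n (\<lambda>t. \<Sum>i\<in>I. f i t)"
  using assms by (induction I rule: infinite_finite_induct) (auto intro: trig_poly.add trig_poly_zero)

lemma trig_poly_shift:
  assumes "trig_poly n f" shows "trig_poly n (\<lambda>t. f (a + t))"
  using assms
proof induction
  case (cos j)
  have "(\<lambda>t. cos (real j * (a + t))) = (\<lambda>t. cos (real j * a) * cos (real j * t) + (- sin (real j * a)) * sin (real j * t))"
    by (auto simp: distrib_left cos_add)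
  then show ?case using cos by (simp only:) (intro trig_poly.intros)
next
  case (sin j)
  have "(\<lambda>t. sin (real j * (a + t))) = (\<lambda>t. sin (real j * a) * cos (real j * t) + cos (real j * a) * sin (real j * t))"
    by (auto simp: distrib_left sin_add)
  then show ?case using sin by (simp only:) (intro trig_poly.intros)
qed (auto intro: trig_poly.intros)

lemma trig_poly_mult_cos:
  assumes "trig_poly n f" shows "trig_poly (Suc n) (\<lambda>t. f t * cos t)"
  using assms
proof induction
  case (cos j)
  \<comment> \<open>Product-to-sum yields the frequencies j + 1 and j - 1. The absolute value covers
    j = 0, where the latter is -1; cosine is even, so no sign appears.\<close>
  have "cos (real (nat \<bar>int j - 1\<bar>) * t) = cos (real j * t - t)" for t
    by (cases j) (auto simp: algebra_simps)
  then have *: "(\<lambda>t. cos (real j * t) * cos t) =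
      (\<lambda>t. 1 / 2 * cos (real (Suc j) * t) + 1 / 2 * cos (real (nat \<bar>int j - 1\<bar>) * t))"
    by (auto simp: distrib_right cos_add cos_diff fun_eq_iff field_simps)
  show ?case unfolding * using cos by (intro trig_poly.intros) auto
next
  case (sin j)
  \<comment> \<open>Sine is odd, so at j = 0 the frequency -1 becomes 1 with a change of
    sign.\<close>
  have "(if j = 0 then -1 else 1) * sin (real (nat \<bar>int j - 1\<bar>) * t) = sin (real j * t - t)" for t
    by (cases j) (auto simp: algebra_simps)
  then have "sin (real j * t) * cos t = 1 / 2 * sin (real (Suc j) * t)
      + (1 / 2) * ((if j = 0 then -1 else 1) * sin (real (nat \<bar>int j - 1\<bar>) * t))" for t
    by (simp only:) (simp add: distrib_right sin_add sin_diff field_simps)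
  then have *: "(\<lambda>t. sin (real j * t) * cos t) = (\<lambda>t. 1 / 2 * sin (real (Suc j) * t)
      + (1 / 2) * ((if j = 0 then -1 else 1) * sin (real (nat \<bar>int j - 1\<bar>) * t)))"
    by blast
  show ?case unfolding * using sin by (intro trig_poly.intros) auto
next
  case (add f g)
  then show ?case using trig_poly.add by (simp add: distrib_right)
next
  case (scale f c)
  then show ?case using trig_poly.scale by (simp add: mult.assoc)
qed

lemma trig_poly_cos_power: "trig_poly i (\<lambda>t. cos t ^ i)"
proof (induction i)
  case 0
  show ?case using trig_poly.cos[of 0 0] by simp
next
  case (Suc i)
  then show ?case using trig_poly_mult_cos by (simp only: power_Suc2)
qed

lemma trig_poly_cos_power_sin: "trig_poly (Suc i) (\<lambda>t. cos t ^ i * sin t)"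
proof (induction i)
  case 0
  show ?case using trig_poly.sin[of 1 1] by simp
next
  case (Suc i)
  have *: "(\<lambda>t::real. cos t ^ Suc i * sin t) = (\<lambda>t. cos t ^ i * sin t * cos t)"
    by (auto simp: mult_ac)
  show ?case unfolding * by (rule trig_poly_mult_cos[OF Suc])
qed

lemma trig_poly_poly_cos:
  assumes "degree p \<le> n" shows "trig_poly n (\<lambda>t. poly p (a * cos t))"
  unfolding poly_altdef power_mult_distrib mult.assoc[symmetric]
  using assms by (auto intro!: trig_poly_sum trig_poly.scale intro: trig_poly_mono[OF trig_poly_cos_power])

text \<open>The factor sin t takes up one degree, hence the strict bound. The scale \<open>a\<close>
  provides the contracted argument in the proof of Markov's inequality.\<close>

lemma trig_poly_poly_cos_sin:
  assumes "degree p < n" shows "trig_poly n (\<lambda>t. poly p (a * cos t) * sin t)"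
  unfolding poly_altdef power_mult_distrib sum_distrib_right
proof (rule trig_poly_sum)
  fix i assume "i \<in> {..degree p}"
  then have "trig_poly n (\<lambda>t. (coeff p i * a ^ i) * (cos t ^ i * sin t))"
    using assms by (auto intro!: trig_poly.scale intro: trig_poly_mono[OF trig_poly_cos_power_sin])
  then show "trig_poly n (\<lambda>t. coeff p i * (a ^ i * cos t ^ i) * sin t)"
    by (simp add: mult_ac)
qed

section \<open>The interpolation formula of M. Riesz\<close>

definition riesz_node :: "nat \<Rightarrow> nat \<Rightarrow> real" where
  "riesz_node n k = (2 * real k + 1) * pi / (2 * real n)"

text \<open>For k < 2 n the nodes theta_k are the zeros of cos (n t) in (0, 2 pi), where sin (n t) =
  (-1)^k. So these are the classical weights (-1)^k / (4 n sin^2 (theta_k / 2)); writing the sign as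
  a sine makes product formulas applicable.\<close>

definition riesz_weight :: "nat \<Rightarrow> nat \<Rightarrow> real" where
  "riesz_weight n k = sin (n * riesz_node n k) / (4 * n * (sin (riesz_node n k / 2))\<^sup>2)"

lemma sin_half_riesz_node_pos:
  assumes "k < 2 * n" shows "sin (riesz_node n k / 2) > 0"
proof (rule sin_gt_zero)
  have "real k + 1 \<le> 2 * real n" using assms by linarith
  then have "(2 * real k + 1) * pi < (4 * real n) * pi"
    by (intro mult_strict_right_mono) auto
  then show "riesz_node n k / 2 < pi"
    using assms by (simp add: riesz_node_def divide_simps mult_ac)
qed (use assms in \<open>simp add: riesz_node_def\<close>)

lemma riesz_node_mult_cos:
  assumes "n > 0" shows "cos (n * riesz_node n k) = 0"
proof -
  have "n * riesz_node n k = of_int (2 * int k + 1) * (pi / 2)"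
    using assms by (simp add: riesz_node_def)
  then show ?thesis unfolding cos_zero_iff_int by (intro exI[of _ "2 * int k + 1"]) simp
qed

lemma riesz_node_mult_sin_sq:
  assumes "n > 0" shows "(sin (n * riesz_node n k))\<^sup>2 = 1"
  using sin_cos_squared_add[of "n * riesz_node n k"] riesz_node_mult_cos[OF assms] by simp

text \<open>With \<open>a\<close> half the step of the arguments, the factor 2 sin a makes the sum
  telescope from sin 0 to sin (2 r pi). The bounds on \<open>r\<close> place \<open>a\<close> in (0,
  pi), so the factor can be cancelled.\<close>

lemma sum_cos_riesz_node:
  assumes "0 < r" "r < 2 * n"
  shows "(\<Sum>k<2*n. cos (real r * riesz_node n k)) = 0"
proof -
  define a where "a = r * pi / (2 * n)"
  have "2 * sin a * (\<Sum>k<2*n. cos (real r * riesz_node n k))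
      = (\<Sum>k<2*n. sin (2 * real (Suc k) * a) - sin (2 * real k * a))"
    unfolding sum_distrib_left
  proof (rule sum.cong)
    fix k
    have "real r * riesz_node n k = (2 * real k * a) + a"
      by (simp add: riesz_node_def a_def add_divide_distrib algebra_simps)
    moreover have "2 * real (Suc k) * a = (2 * real k * a + a) + a"
      by (simp add: algebra_simps)
    moreover have "sin (2 * real k * a) = sin ((2 * real k * a + a) - a)" by simp
    ultimately show "2 * sin a * cos (real r * riesz_node n k) =
        sin (2 * real (Suc k) * a) - sin (2 * real k * a)"
      by (simp only: sin_add[of _ a] sin_diff) (simp add: algebra_simps)
  qed simp
  also have "\<dots> = sin (2 * real (2 * n) * a)"
    by (subst sum_lessThan_telescope) simp
  also have "2 * real (2 * n) * a = (2 * real r) * pi"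
    using assms by (simp add: a_def)
  also have "sin \<dots> = 0"
    by (metis of_nat_mult of_nat_numeral sin_npi)
  finally have "2 * sin a * (\<Sum>k<2*n. cos (real r * riesz_node n k)) = 0" .
  moreover have "sin a > 0"
  proof (rule sin_gt_zero)
    have "real r * pi < (2 * real n) * pi" using assms
      by (intro mult_strict_right_mono) auto
    then show "a < pi" using assms by (simp add: a_def divide_simps mult_ac)
  qed (use assms in \<open>simp add: a_def\<close>)
  ultimately show ?thesis by simp
qed

text \<open>The second difference in \<open>j\<close> cancels the denominator of the weights, since
  \<open>2 - 2 cos \<theta> = 4 sin\<^sup>2 (\<theta>/2)\<close>.\<close>

lemma riesz_second_difference:
  assumes "n > 0"
  shows "(\<Sum>k<2*n. riesz_weight n k * sin ((x + 1) * riesz_node n k))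
       + (\<Sum>k<2*n. riesz_weight n k * sin ((x - 1) * riesz_node n k))
       - 2 * (\<Sum>k<2*n. riesz_weight n k * sin (x * riesz_node n k))
       = - (\<Sum>k<2*n. sin (n * riesz_node n k) * sin (x * riesz_node n k)) / n"
  unfolding sum_distrib_left sum.distrib[symmetric] sum_subtractf[symmetric]
    sum_negf[symmetric] sum_divide_distrib
proof (rule sum.cong)
  fix k assume "k \<in> {..<2*n}"
  let ?t = "riesz_node n k"
  have s: "sin (?t / 2) \<noteq> 0" using sin_half_riesz_node_pos[of k n] \<open>k \<in> _\<close> by simp
  have c: "cos ?t = 1 - 2 * (sin (?t / 2))\<^sup>2" using cos_double_sin[of "?t / 2"] by simp
  have "sin ((x + 1) * ?t) + sin ((x - 1) * ?t) - 2 * sin (x * ?t)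
      = - 4 * (sin (?t / 2))\<^sup>2 * sin (x * ?t)"
    by (simp add: distrib_right left_diff_distrib sin_add sin_diff c right_diff_distrib)
  moreover have "riesz_weight n k * sin ((x + 1) * ?t) + riesz_weight n k * sin ((x - 1) * ?t)
      - 2 * (riesz_weight n k * sin (x * ?t))
      = riesz_weight n k * (sin ((x + 1) * ?t) + sin ((x - 1) * ?t) - 2 * sin (x * ?t))"
    by (simp only: distrib_left right_diff_distrib mult.left_commute)
  ultimately have "riesz_weight n k * sin ((x + 1) * ?t) + riesz_weight n k * sin ((x - 1) * ?t)
      - 2 * (riesz_weight n k * sin (x * ?t))
      = riesz_weight n k * (- 4 * (sin (?t / 2))\<^sup>2 * sin (x * ?t))"
    by (simp only:)
  also have "\<dots> = - (sin (n * ?t) * sin (x * ?t)) / n"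
    using assms s by (simp add: riesz_weight_def field_simps)
  finally show "riesz_weight n k * sin ((x + 1) * ?t) + riesz_weight n k * sin ((x - 1) * ?t)
      - 2 * (riesz_weight n k * sin (x * ?t)) = - (sin (n * ?t) * sin (x * ?t)) / n" .
qed simp

text \<open>This is Riesz' formula for sin (j t), whose derivative at 0 is j. The second difference
  vanishes for 0 < j < n, so the sum is linear in j; the second difference at j = n fixes the
  slope.\<close>

lemma riesz_sum_sin:
  assumes "j \<le> n" "n > 0"
  shows "(\<Sum>k<2*n. riesz_weight n k * sin (real j * riesz_node n k)) = j"
proof -
  define D where "D x = (\<Sum>k<2*n. riesz_weight n k * sin (x * riesz_node n k))" for x :: real
  have D0: "D 0 = 0" by (simp add: D_def)
  have rec: "D (real (Suc (Suc j))) = 2 * D (real (Suc j)) - D (real j)" if "Suc j < n" for j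
  proof -
    \<comment> \<open>The product splits into cosines of frequencies n - (j + 1) and n + (j + 1).
      Both lie strictly between 0 and 2 n because j + 1 < n, so each sum vanishes.\<close>
    have "(\<Sum>k<2*n. sin (n * riesz_node n k) * sin (real (Suc j) * riesz_node n k))
        = (\<Sum>k<2*n. 1/2 * (cos (real (n - Suc j) * riesz_node n k) - cos (real (n + Suc j) * riesz_node n k)))"
    proof (rule sum.cong)
      fix k
      have "real (n - Suc j) * riesz_node n k = real n * riesz_node n k - real (Suc j) * riesz_node n k"
        "real (n + Suc j) * riesz_node n k = real n * riesz_node n k + real (Suc j) * riesz_node n k"
        using that by (simp_all add: of_nat_diff algebra_simps)
      then show "sin (n * riesz_node n k) * sin (real (Suc j) * riesz_node n k)
        = 1/2 * (cos (real (n - Suc j) * riesz_node n k) - cos (real (n + Suc j) * riesz_node n k))"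
        by (simp only: cos_diff cos_add) (simp del: of_nat_Suc)
    qed simp
    also have "\<dots> = 0"
      unfolding sum_distrib_left[symmetric] sum_subtractf
      using that by (subst (1 2) sum_cos_riesz_node) auto
    finally show ?thesis
      using riesz_second_difference[OF assms(2), of "real (Suc j)"] by (simp add: D_def algebra_simps)
  qed
  have lin: "D (real j) = j * D 1" if "j \<le> n" for j
    using that
  proof (induction j rule: induct_nat_012)
    case (ge2 j)
    then show ?case using rec[of j] by (simp add: algebra_simps)
  qed (simp_all add: D0)
  \<comment> \<open>Since cos (n t) vanishes at the nodes, n + 1 reflects to n - 1. The second
    difference at n is therefore 2 (D (n - 1) - D n) = -2 D 1, and it equals -2.\<close>
  have "D (real n + 1) = D (real n - 1)"
    unfolding D_def using riesz_node_mult_cos[OF assms(2)]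
    by (intro sum.cong) (simp_all add: distrib_right left_diff_distrib sin_add sin_diff)
  moreover have "D (real n - 1) = (real n - 1) * D 1"
    using lin[of "n - 1"] assms(2) by (simp add: of_nat_diff)
  moreover have "D (real n + 1) + D (real n - 1) - 2 * D (real n) = - 2"
    using riesz_second_difference[OF assms(2), of "real n"] riesz_node_mult_sin_sq[OF assms(2)] assms(2)
    by (simp add: D_def power2_eq_square)
  ultimately have "D 1 = 1" using lin[of n] by (simp add: algebra_simps)
  then show ?thesis using lin[OF assms(1)] by (simp add: D_def)
qed

text \<open>As sin (n t) is 1 or -1 at the nodes and gives the weight its sign, multiplying by it
  yields the absolute value: this is the case j = n of \<open>riesz_sum_sin\<close>. The total is
  the constant in Bernstein's inequality.\<close>

lemma sum_abs_riesz_weight: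
  assumes "n > 0" shows "(\<Sum>k<2*n. \<bar>riesz_weight n k\<bar>) = n"
proof -
  have "\<bar>riesz_weight n k\<bar> = riesz_weight n k * sin (n * riesz_node n k)" for k
  proof -
    have "\<bar>sin (n * riesz_node n k)\<bar> = sin (n * riesz_node n k) * sin (n * riesz_node n k)"
      using riesz_node_mult_sin_sq[OF assms, of k] by (auto simp: power2_eq_1_iff)
    then show ?thesis unfolding riesz_weight_def by (simp add: abs_mult)
  qed
  then show ?thesis using riesz_sum_sin[of n n] assms by simp
qed

text \<open>Only the odd part of \<open>f\<close> enters: cosines give zero on both sides, sines
  reduce to \<open>riesz_sum_sin\<close>, and both sides are linear in \<open>f\<close>.\<close>

lemma riesz_interpolation_formula:
  assumes "trig_poly n f" "n > 0"
  shows "(f has_real_derivative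
    (\<Sum>k<2*n. riesz_weight n k * ((f (riesz_node n k) - f (- riesz_node n k)) / 2))) (at 0)"
  using assms(1)
proof induction
  case (cos j)
  show ?case by (auto intro!: derivative_eq_intros)
next
  case (sin j)
  show ?case using riesz_sum_sin[OF sin assms(2)] by (auto intro!: derivative_eq_intros)
next
  case (add f g)
  have eq: "(\<Sum>k<2*n. riesz_weight n k * ((f (riesz_node n k) + g (riesz_node n k) - (f (- riesz_node n k) + g (- riesz_node n k))) / 2))
     = (\<Sum>k<2*n. riesz_weight n k * ((f (riesz_node n k) - f (- riesz_node n k)) / 2))
     + (\<Sum>k<2*n. riesz_weight n k * ((g (riesz_node n k) - g (- riesz_node n k)) / 2))"
    unfolding sum.distrib[symmetric] by (intro sum.cong) (simp_all add: field_simps)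
  show ?case unfolding eq using add.IH by (rule DERIV_add)
next
  case (scale f c)
  have eq: "(\<Sum>k<2*n. riesz_weight n k * ((c * f (riesz_node n k) - c * f (- riesz_node n k)) / 2))
     = c * (\<Sum>k<2*n. riesz_weight n k * ((f (riesz_node n k) - f (- riesz_node n k)) / 2))"
    unfolding sum_distrib_left by (intro sum.cong) (simp_all add: field_simps)
  show ?case unfolding eq using scale.IH by (rule DERIV_cmult)
qed

section \<open>Bernstein's and Markov's inequalities\<close>

lemma bernstein_inequality:
  fixes B :: real
  assumes f: "trig_poly n f" and n: "n > 0" and B: "\<And>t. \<bar>f t\<bar> \<le> B"
    and d: "(f has_real_derivative d) (at a)"
  shows "\<bar>d\<bar> \<le> n * B"
proof -
  \<comment> \<open>Translation moves the point to 0 and preserves degree and bound. Riesz' formula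
    then estimates \<open>d\<close> by \<open>B\<close> times the sum of the absolute
    weights.\<close>
  define g where "g t = f (a + t)" for t
  have "(g has_real_derivative d) (at 0)"
    unfolding g_def using d DERIV_shift[of f d 0 a] by (simp add: add.commute)
  moreover have "trig_poly n g" unfolding g_def by (rule trig_poly_shift[OF f])
  ultimately have "d = (\<Sum>k<2*n. riesz_weight n k * ((g (riesz_node n k) - g (- riesz_node n k)) / 2))"
    using riesz_interpolation_formula[OF _ n] DERIV_unique by blast
  also have "\<bar>\<dots>\<bar> \<le> (\<Sum>k<2*n. \<bar>riesz_weight n k\<bar> * B)"
  proof (rule sum_abs[THEN order_trans], rule sum_mono)
    fix k
    have "\<bar>(g (riesz_node n k) - g (- riesz_node n k)) / 2\<bar> \<le> B"
      using B[of "a + riesz_node n k"] B[of "a - riesz_node n k"] unfolding g_def by (simp add: abs_le_iff)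
    then show "\<bar>riesz_weight n k * ((g (riesz_node n k) - g (- riesz_node n k)) / 2)\<bar> \<le> \<bar>riesz_weight n k\<bar> * B"
      unfolding abs_mult by (intro mult_left_mono) auto
  qed
  also have "\<dots> = n * B" using sum_abs_riesz_weight[OF n] by (simp add: sum_distrib_right[symmetric])
  finally show ?thesis .
qed

text \<open>Bernstein's inequality for \<open>p (cos t)\<close> bounds \<open>p' (cos t) * sin t\<close>, hence also
  \<open>p' (a * cos t) * sin t\<close> for \<open>\<bar>a\<bar> \<le> 1\<close>; the derivative of the latter at \<open>0\<close> is \<open>p' a\<close>.\<close>

lemma markov_inequality:
  fixes p :: "real poly"
  assumes deg: "degree p \<le> n" and B: "\<And>x. \<bar>x\<bar> \<le> 1 \<Longrightarrow> \<bar>poly p x\<bar> \<le> B" and a: "\<bar>a\<bar> \<le> 1"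
  shows "\<bar>poly (pderiv p) a\<bar> \<le> (real n)\<^sup>2 * B"
proof (cases "n = 0")
  case True
  then have "pderiv p = 0" using deg by (simp add: pderiv_eq_0_iff)
  then show ?thesis using True by simp
next
  case False
  have first: "\<bar>poly (pderiv p) (cos t) * sin t\<bar> \<le> n * B" for t
  proof -
    have "((\<lambda>t. poly p (cos t)) has_real_derivative - (poly (pderiv p) (cos t) * sin t)) (at t)"
      by (auto intro!: derivative_eq_intros)
    then show ?thesis
      using bernstein_inequality[of n "\<lambda>t. poly p (cos t)" B _ t] trig_poly_poly_cos[OF deg, of 1] False B
      by fastforce
  qed
  have second: "\<bar>poly (pderiv p) (a * cos t) * sin t\<bar> \<le> n * B" for t
  proof -
    have le: "\<bar>a * cos t\<bar> \<le> \<bar>cos t\<bar>" using a by (simp add: abs_mult mult_left_le_one_le)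
    have le1: "\<bar>a * cos t\<bar> \<le> 1" using le abs_cos_le_one[of t] by linarith
    \<comment> \<open>Contracting the cosine enlarges the sine: a cos t = cos s with |sin s| \<ge>
      |sin t|, so the first estimate at \<open>s\<close> yields the second at
      \<open>t\<close>.\<close>
    define s where "s = arccos (a * cos t)"
    have s: "cos s = a * cos t" unfolding s_def using le1 by (intro cos_arccos_abs)
    have "(cos s)\<^sup>2 \<le> (cos t)\<^sup>2" unfolding s using le by (simp add: abs_le_square_iff)
    then have "(sin t)\<^sup>2 \<le> (sin s)\<^sup>2"
      using sin_cos_squared_add[of s] sin_cos_squared_add[of t] by linarith
    then have "\<bar>sin t\<bar> \<le> \<bar>sin s\<bar>" by (simp add: abs_le_square_iff)
    then have "\<bar>poly (pderiv p) (cos s) * sin t\<bar> \<le> \<bar>poly (pderiv p) (cos s) * sin s\<bar>"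
      unfolding abs_mult by (rule mult_left_mono) simp
    then show ?thesis using first[of s] unfolding s by linarith
  qed
  have "degree (pderiv p) < n" using False deg by (simp add: degree_pderiv)
  then have "trig_poly n (\<lambda>t. poly (pderiv p) (a * cos t) * sin t)"
    by (rule trig_poly_poly_cos_sin)
  moreover have "((\<lambda>t. poly (pderiv p) (a * cos t) * sin t) has_real_derivative poly (pderiv p) a) (at 0)"
    by (auto intro!: derivative_eq_intros)
  \<comment> \<open>Bernstein's inequality is applied a second time, now with the bound n B, which
    produces the factor n^2.\<close>
  ultimately have "\<bar>poly (pderiv p) a\<bar> \<le> n * (n * B)"
    using bernstein_inequality[of n "\<lambda>t. poly (pderiv p) (a * cos t) * sin t" "n * B" _ 0] second False
    by blast
  then show ?thesis by (simp add: power2_eq_square)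
qed

section \<open>Linear systems and interpolation by bivariate polynomials\<close>

text \<open>Gaussian elimination, by induction on the equations: a nonzero entry of the new row is a
  pivot that removes one unknown from the others; without a pivot the row holds trivially.\<close>

lemma underdetermined_system_nontrivial:
  fixes A :: "'x \<Rightarrow> 'i \<Rightarrow> 'a::field"
  assumes "finite X" "finite I" "card X < card I"
  shows "\<exists>c. (\<exists>i\<in>I. c i \<noteq> 0) \<and> (\<forall>x\<in>X. (\<Sum>i\<in>I. A x i * c i) = 0)"
  using assms
proof (induction X arbitrary: I A rule: finite_induct)
  case empty
  then have "\<exists>i. i \<in> I" by (metis card.empty equals0I less_irrefl)
  then show ?case by (intro exI[of _ "\<lambda>_. 1"]) auto
next
  case (insert x0 X)
  show ?case
  proof (cases "\<forall>i\<in>I. A x0 i = 0")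
    case True
    obtain c where "\<exists>i\<in>I. c i \<noteq> 0" "\<forall>x\<in>X. (\<Sum>i\<in>I. A x i * c i) = 0"
      using insert.IH[of I A] insert.prems insert.hyps by auto
    then show ?thesis using True by (intro exI[of _ c]) auto
  next
    case False
    then obtain i0 where i0: "i0 \<in> I" "A x0 i0 \<noteq> 0" by auto
    define J where "J = I - {i0}"
    have J: "finite J" "i0 \<notin> J" "I = insert i0 J"
      using i0 insert.prems by (auto simp: J_def)
    have "card X < card J" using insert.prems insert.hyps J by simp
    then obtain c where c: "\<exists>i\<in>J. c i \<noteq> 0"
      "\<forall>x\<in>X. (\<Sum>i\<in>J. (A x i - A x i0 * A x0 i / A x0 i0) * c i) = 0"
      using insert.IH[of J "\<lambda>x i. A x i - A x i0 * A x0 i / A x0 i0"] J by auto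
    \<comment> \<open>Back substitution: the pivot unknown is chosen to satisfy the row
      \<open>x0\<close>.\<close>
    define e where "e = c(i0 := - (\<Sum>i\<in>J. A x0 i * c i) / A x0 i0)"
    have sum_e: "(\<Sum>i\<in>I. A x i * e i)
        = (\<Sum>i\<in>J. A x i * c i) - A x i0 * (\<Sum>i\<in>J. A x0 i * c i) / A x0 i0" for x
    proof -
      have "(\<Sum>i\<in>J. A x i * e i) = (\<Sum>i\<in>J. A x i * c i)"
        using J by (intro sum.cong) (auto simp: e_def)
      then show ?thesis using J by (simp add: e_def)
    qed
    have "(\<Sum>i\<in>I. A x i * e i) = 0" if "x \<in> X" for x
    proof -
      have "0 = (\<Sum>i\<in>J. (A x i - A x i0 * A x0 i / A x0 i0) * c i)" using c that by simp
      also have "\<dots> = (\<Sum>i\<in>J. A x i * c i) - (\<Sum>i\<in>J. A x i0 / A x0 i0 * (A x0 i * c i))"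
        unfolding sum_subtractf[symmetric] by (intro sum.cong) (simp_all add: algebra_simps)
      also have "\<dots> = (\<Sum>i\<in>I. A x i * e i)"
        unfolding sum_e sum_distrib_left[symmetric] by simp
      finally show ?thesis by simp
    qed
    moreover have "(\<Sum>i\<in>I. A x0 i * e i) = 0" using i0 by (simp add: sum_e)
    moreover have "\<exists>i\<in>I. e i \<noteq> 0" using c J by (auto simp: e_def)
    ultimately show ?thesis by (intro exI[of _ e]) auto
  qed
qed

text \<open>The right-hand side becomes an extra column, indexed by \<open>None\<close>, so the
  homogeneous system is underdetermined. Injectivity forces the coefficient of that column to be
  nonzero, and dividing by it gives the solution.\<close>

lemma square_system_solvable:
  fixes A :: "'x \<Rightarrow> 'i \<Rightarrow> 'a::field"
  assumes "finite X" "finite I" "card X = card I"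
    and inj: "\<And>c. (\<And>x. x \<in> X \<Longrightarrow> (\<Sum>i\<in>I. A x i * c i) = 0) \<Longrightarrow> (\<And>i. i \<in> I \<Longrightarrow> c i = 0)"
  shows "\<exists>c. \<forall>x\<in>X. (\<Sum>i\<in>I. A x i * c i) = d x"
proof -
  define J where "J = insert None (Some ` I)"
  have "card X < card J" using assms by (simp add: J_def card_image card_insert_if)
  moreover have "finite J" using assms by (simp add: J_def)
  ultimately obtain c where c: "\<exists>j\<in>J. c j \<noteq> 0"
    "\<forall>x\<in>X. (\<Sum>j\<in>J. (case j of None \<Rightarrow> - d x | Some i \<Rightarrow> A x i) * c j) = 0"
    using underdetermined_system_nontrivial[of X J "\<lambda>x j. case j of None \<Rightarrow> - d x | Some i \<Rightarrow> A x i"]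
      assms(1) by blast
  have c': "(\<Sum>i\<in>I. A x i * c (Some i)) = d x * c None" if "x \<in> X" for x
    using c(2) that assms(2) unfolding J_def by (simp add: sum.reindex)
  have "c None \<noteq> 0"
  proof
    assume "c None = 0"
    then have "c (Some i) = 0" if "i \<in> I" for i
      using inj[of "\<lambda>i. c (Some i)"] c' that by simp
    with \<open>c None = 0\<close> c(1) show False by (auto simp: J_def)
  qed
  then have "(\<Sum>i\<in>I. A x i * (c (Some i) / c None)) = d x" if "x \<in> X" for x
    using c'[OF that] by (simp add: sum_divide_distrib[symmetric])
  then show ?thesis by (intro exI[of _ "\<lambda>i. c (Some i) / c None"]) blast
qed

section \<open>Bivariate polynomials: coefficients, slices, interpolation\<close>

definition bipoly_index :: "nat \<Rightarrow> (nat \<times> nat) set" where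
  "bipoly_index m = {(i, j). i + j \<le> m}"

definition bipoly_of :: "nat \<Rightarrow> (nat \<times> nat \<Rightarrow> real) \<Rightarrow> plane \<Rightarrow> real" where
  "bipoly_of m c z = (\<Sum>k\<in>bipoly_index m. c k * (fst z ^ fst k * snd z ^ snd k))"

lemma bipoly_eq_range: "bipoly m = range (bipoly_of m)"
proof -
  have "(\<lambda>(x, y). \<Sum>(i, j)\<in>{(i, j). i + j \<le> m}. c i j * x ^ i * y ^ j) = bipoly_of m (\<lambda>(i, j). c i j)" for c
    by (auto simp: fun_eq_iff bipoly_of_def bipoly_index_def case_prod_beta mult.assoc)
  then have "bipoly m = range (\<lambda>c. bipoly_of m (\<lambda>(i, j). c i j))"
    unfolding bipoly_def by auto
  also have "\<dots> = range (bipoly_of m)"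
  proof (intro equalityI subsetI)
    fix p assume "p \<in> range (bipoly_of m)"
    then obtain c where "p = bipoly_of m c" by blast
    then show "p \<in> range (\<lambda>c. bipoly_of m (\<lambda>(i, j). c i j))"
      by (intro range_eqI[of _ _ "curry c"]) simp
  qed blast
  finally show ?thesis .
qed

lemma bipoly_index_Suc:
  "bipoly_index (Suc m) = bipoly_index m \<union> (\<lambda>i. (i, Suc m - i)) ` {..Suc m}"
  by (auto simp: bipoly_index_def image_iff)

lemma finite_bipoly_index [simp]: "finite (bipoly_index m)"
  by (rule finite_subset[of _ "{..m} \<times> {..m}"]) (auto simp: bipoly_index_def)

lemma card_bipoly_index: "card (bipoly_index m) = bipoly_dim m"
proof -
  have "2 * card (bipoly_index m) = (m + 1) * (m + 2)"
  proof (induction m)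
    case 0
    have "bipoly_index 0 = {(0, 0)}" by (auto simp: bipoly_index_def)
    then show ?case by simp
  next
    case (Suc m)
    have "card ((\<lambda>i. (i, Suc m - i)) ` {..Suc m}) = Suc m + 1"
      by (subst card_image) (auto simp: inj_on_def)
    moreover have "bipoly_index m \<inter> (\<lambda>i. (i, Suc m - i)) ` {..Suc m} = {}"
      by (auto simp: bipoly_index_def)
    ultimately have "card (bipoly_index (Suc m)) = card (bipoly_index m) + (Suc m + 1)"
      unfolding bipoly_index_Suc by (subst card_Un_disjoint) auto
    then show ?case using Suc by simp
  qed
  then show ?thesis unfolding bipoly_dim_def by simp
qed

lemma bipoly_zero: "(\<lambda>_. 0) \<in> bipoly m"
  unfolding bipoly_eq_range by (rule range_eqI[of _ _ "\<lambda>_. 0"]) (auto simp: bipoly_of_def)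

lemma bipoly_add:
  assumes "p \<in> bipoly m" "q \<in> bipoly m" shows "(\<lambda>z. p z + q z) \<in> bipoly m"
proof -
  obtain c d where "p = bipoly_of m c" "q = bipoly_of m d" using assms unfolding bipoly_eq_range by auto
  then have "(\<lambda>z. p z + q z) = bipoly_of m (\<lambda>k. c k + d k)"
    by (auto simp: bipoly_of_def distrib_right sum.distrib)
  then show ?thesis unfolding bipoly_eq_range by blast
qed

lemma bipoly_scale:
  assumes "p \<in> bipoly m" shows "(\<lambda>z. a * p z) \<in> bipoly m"
proof -
  obtain c where "p = bipoly_of m c" using assms unfolding bipoly_eq_range by auto
  then have "(\<lambda>z. a * p z) = bipoly_of m (\<lambda>k. a * c k)"
    by (auto simp: bipoly_of_def sum_distrib_left mult.assoc)
  then show ?thesis unfolding bipoly_eq_range by blast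
qed

lemma bipoly_diff:
  assumes "p \<in> bipoly m" "q \<in> bipoly m" shows "(\<lambda>z. p z - q z) \<in> bipoly m"
  using bipoly_add[OF assms(1) bipoly_scale[OF assms(2), of "-1"]] by simp

lemma bipoly_sum:
  assumes "\<And>i. i \<in> I \<Longrightarrow> p i \<in> bipoly m" shows "(\<lambda>z. \<Sum>i\<in>I. a i * p i z) \<in> bipoly m"
  using assms by (induction I rule: infinite_finite_induct) (simp_all add: bipoly_add bipoly_scale bipoly_zero)

lemma bipoly_monomial:
  assumes "k \<in> bipoly_index m" shows "(\<lambda>z. fst z ^ fst k * snd z ^ snd k) \<in> bipoly m"
proof -
  have "(\<lambda>z::plane. fst z ^ fst k * snd z ^ snd k) = bipoly_of m (\<lambda>l. if l = k then 1 else 0)"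
    using assms by (auto simp: bipoly_of_def fun_eq_iff if_distrib[of "\<lambda>u. u * _"] cong: if_cong)
  then show ?thesis unfolding bipoly_eq_range by blast
qed

lemma continuous_on_bipoly:
  assumes "p \<in> bipoly m" shows "continuous_on S p"
proof -
  obtain c where "p = bipoly_of m c" using assms unfolding bipoly_eq_range by auto
  moreover have "continuous_on S (bipoly_of m c)"
    unfolding bipoly_of_def by (intro continuous_intros)
  ultimately show ?thesis by simp
qed

text \<open>Axis-parallel slices make the univariate Markov inequality applicable to
  \<open>p\<close>.\<close>

lemma bipoly_slice_fst:
  assumes "p \<in> bipoly m" obtains q where "degree q \<le> m" "\<And>x. poly q x = p (x, y)"
proof -
  obtain c where c: "p = bipoly_of m c" using assms unfolding bipoly_eq_range by auto
  define q where "q = (\<Sum>k\<in>bipoly_index m. monom (c k * y ^ snd k) (fst k))"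
  have "degree q \<le> m" unfolding q_def
    by (intro degree_sum_le order.trans[OF degree_monom_le] finite_bipoly_index)
      (auto simp: bipoly_index_def)
  moreover have "poly q x = p (x, y)" for x
    by (auto simp: q_def c bipoly_of_def poly_sum poly_monom mult_ac)
  ultimately show ?thesis using that by blast
qed

lemma bipoly_slice_snd:
  assumes "p \<in> bipoly m" obtains q where "degree q \<le> m" "\<And>y. poly q y = p (x, y)"
proof -
  obtain c where c: "p = bipoly_of m c" using assms unfolding bipoly_eq_range by auto
  define q where "q = (\<Sum>k\<in>bipoly_index m. monom (c k * x ^ fst k) (snd k))"
  have "degree q \<le> m" unfolding q_def
    by (intro degree_sum_le order.trans[OF degree_monom_le] finite_bipoly_index)
      (auto simp: bipoly_index_def)
  moreover have "poly q y = p (x, y)" for y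
    by (auto simp: q_def c bipoly_of_def poly_sum poly_monom mult_ac)
  ultimately show ?thesis using that by blast
qed

text \<open>For fixed y a polynomial in x vanishes identically, hence so do its coefficients; the
  coefficient of x^i is the value at y of the polynomial \<open>r i\<close>, which is then zero
  too.\<close>

lemma bipoly_of_eq_zero:
  assumes "bipoly_of m c = (\<lambda>_. 0)" "k \<in> bipoly_index m" shows "c k = 0"
proof -
  define r where "r i = (\<Sum>k\<in>bipoly_index m. monom (if fst k = i then c k else 0) (snd k))" for i
  have "poly (r i) y = 0" for i y
  proof -
    define q where "q = (\<Sum>k\<in>bipoly_index m. monom (c k * y ^ snd k) (fst k))"
    have "poly q x = bipoly_of m c (x, y)" for x
      by (auto simp: q_def bipoly_of_def poly_sum poly_monom mult_ac)
    then have "q = 0" using assms(1) by (intro iffD1[OF poly_all_0_iff_0]) simp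
    then have "0 = coeff q i" by simp
    also have "\<dots> = poly (r i) y"
      unfolding q_def r_def coeff_sum poly_sum
      by (intro sum.cong) (auto simp: poly_monom coeff_monom)
    finally show ?thesis by simp
  qed
  then have "r (fst k) = 0" by (intro iffD1[OF poly_all_0_iff_0]) simp
  then have "0 = coeff (r (fst k)) (snd k)" by simp
  also have "\<dots> = (\<Sum>l\<in>bipoly_index m. if l = k then c l else 0)"
    unfolding r_def coeff_sum by (intro sum.cong) (auto simp: coeff_monom prod_eq_iff)
  also have "\<dots> = c k" using assms(2) by simp
  finally show ?thesis by simp
qed

text \<open>The functionals \<open>\<Lambda> x\<close> are point evaluations or averages over
  triangles, so both Lagrange bases come from here. Linearity is asked on \<open>bipoly m\<close>
  only, as averages are additive on integrable functions.\<close>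

lemma bipoly_unisolvent_interpolation:
  fixes \<Lambda> :: "'x \<Rightarrow> (plane \<Rightarrow> real) \<Rightarrow> real"
  assumes "finite X" "card X = bipoly_dim m"
    and add: "\<And>x p q. x \<in> X \<Longrightarrow> p \<in> bipoly m \<Longrightarrow> q \<in> bipoly m \<Longrightarrow> \<Lambda> x (\<lambda>z. p z + q z) = \<Lambda> x p + \<Lambda> x q"
    and scale: "\<And>x p a. x \<in> X \<Longrightarrow> p \<in> bipoly m \<Longrightarrow> \<Lambda> x (\<lambda>z. a * p z) = a * \<Lambda> x p"
    and inj: "\<And>p. p \<in> bipoly m \<Longrightarrow> (\<And>x. x \<in> X \<Longrightarrow> \<Lambda> x p = 0) \<Longrightarrow> p = (\<lambda>_. 0)"
  shows "\<exists>p\<in>bipoly m. \<forall>x\<in>X. \<Lambda> x p = d x"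
proof -
  let ?mono = "\<lambda>k z. fst z ^ fst k * snd z ^ snd k :: real"
  have zero: "\<Lambda> x (\<lambda>_. 0) = 0" if "x \<in> X" for x
    using scale[OF that bipoly_zero, of 0] by simp
  have \<Lambda>_sum: "\<Lambda> x (bipoly_of m c) = (\<Sum>k\<in>bipoly_index m. \<Lambda> x (?mono k) * c k)" if "x \<in> X" for x c
  proof -
    have "\<Lambda> x (\<lambda>z. \<Sum>k\<in>I. c k * ?mono k z) = (\<Sum>k\<in>I. \<Lambda> x (?mono k) * c k)" if "I \<subseteq> bipoly_index m" for I
      using finite_subset[OF that finite_bipoly_index] that
    proof (induction I rule: finite_induct)
      case empty
      then show ?case using zero[OF \<open>x \<in> X\<close>] by simp
    next
      case (insert k I)
      have "\<Lambda> x (\<lambda>z. c k * ?mono k z + (\<Sum>k\<in>I. c k * ?mono k z))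
          = \<Lambda> x (\<lambda>z. c k * ?mono k z) + \<Lambda> x (\<lambda>z. \<Sum>k\<in>I. c k * ?mono k z)"
        using insert.prems by (intro add \<open>x \<in> X\<close> bipoly_scale bipoly_sum bipoly_monomial) auto
      also have "\<Lambda> x (\<lambda>z. c k * ?mono k z) = c k * \<Lambda> x (?mono k)"
        using insert.prems by (intro scale \<open>x \<in> X\<close> bipoly_monomial) auto
      finally show ?case using insert by simp
    qed
    from this[of "bipoly_index m"] show ?thesis by (simp add: bipoly_of_def[abs_def])
  qed
  have "\<exists>c. \<forall>x\<in>X. (\<Sum>k\<in>bipoly_index m. \<Lambda> x (?mono k) * c k) = d x"
  proof (rule square_system_solvable)
    show "card X = card (bipoly_index m)" using assms by (simp add: card_bipoly_index)
    fix c k assume c: "\<And>x. x \<in> X \<Longrightarrow> (\<Sum>k\<in>bipoly_index m. \<Lambda> x (?mono k) * c k) = 0" and k: "k \<in> bipoly_index m"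
    have "bipoly_of m c = (\<lambda>_. 0)"
      using c \<Lambda>_sum by (intro inj) (auto simp: bipoly_eq_range)
    then show "c k = 0" using k by (rule bipoly_of_eq_zero)
  qed (use assms in auto)
  then obtain c where "\<forall>x\<in>X. (\<Sum>k\<in>bipoly_index m. \<Lambda> x (?mono k) * c k) = d x" by blast
  then show ?thesis using \<Lambda>_sum by (intro bexI[of _ "bipoly_of m c"]) (auto simp: bipoly_eq_range)
qed

section \<open>Averages and Lebesgue constants\<close>

lemma poly_lipschitz_markov:
  fixes p :: "real poly"
  assumes "degree p \<le> n" "\<And>x. \<bar>x\<bar> \<le> 1 \<Longrightarrow> \<bar>poly p x\<bar> \<le> B" "\<bar>a\<bar> \<le> 1" "\<bar>b\<bar> \<le> 1"
  shows "\<bar>poly p a - poly p b\<bar> \<le> (real n)\<^sup>2 * B * \<bar>a - b\<bar>"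
proof -
  have "norm (poly p a - poly p b) \<le> (real n)\<^sup>2 * B * norm (a - b)"
  proof (rule field_differentiable_bound[of "{-1..1}" "poly p" "poly (pderiv p)"])
    show "(poly p has_field_derivative poly (pderiv p) z) (at z within {- 1..1})" for z
      by (rule has_field_derivative_at_within[OF poly_DERIV])
    show "norm (poly (pderiv p) z) \<le> (real n)\<^sup>2 * B" if "z \<in> {-1..1}" for z
      using markov_inequality[OF assms(1,2), of z] that by (simp add: abs_le_iff)
  qed (use assms(3,4) in auto)
  then show ?thesis by simp
qed

text \<open>The path from \<open>u\<close> to \<open>v\<close> goes horizontally and then vertically
  through the corner \<open>(fst v, snd u)\<close>, which stays in the square. Each leg is at most
  \<open>dist u v\<close> long, whence the factor 2.\<close>

lemma bipoly_lipschitz_square: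
  assumes p: "p \<in> bipoly m" and B: "\<And>z. z \<in> square \<Longrightarrow> \<bar>p z\<bar> \<le> B"
    and u: "u \<in> square" and v: "v \<in> square"
  shows "\<bar>p u - p v\<bar> \<le> 2 * (real m)\<^sup>2 * B * dist u v"
proof -
  have sq: "\<bar>fst u\<bar> \<le> 1" "\<bar>snd u\<bar> \<le> 1" "\<bar>fst v\<bar> \<le> 1" "\<bar>snd v\<bar> \<le> 1"
    using u v by (auto simp: square_def)
  have in_sq: "(x, y) \<in> square" if "\<bar>x\<bar> \<le> 1" "\<bar>y\<bar> \<le> 1" for x y
    using that by (auto simp: square_def)
  have "B \<ge> 0" using B[OF u] by linarith
  obtain q where q: "degree q \<le> m" "\<And>x. poly q x = p (x, snd u)" using bipoly_slice_fst[OF p] by blast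
  obtain r where r: "degree r \<le> m" "\<And>y. poly r y = p (fst v, y)" using bipoly_slice_snd[OF p] by blast
  have "\<bar>p u - p (fst v, snd u)\<bar> \<le> (real m)\<^sup>2 * B * \<bar>fst u - fst v\<bar>"
    using poly_lipschitz_markov[OF q(1), of B "fst u" "fst v"] q(2) sq B in_sq by simp
  also have "\<dots> \<le> (real m)\<^sup>2 * B * dist u v"
    using dist_fst_le[of u v] \<open>B \<ge> 0\<close> by (intro mult_left_mono) (auto simp: dist_real_def)
  finally have 1: "\<bar>p u - p (fst v, snd u)\<bar> \<le> (real m)\<^sup>2 * B * dist u v" .
  have "\<bar>p (fst v, snd u) - p v\<bar> \<le> (real m)\<^sup>2 * B * \<bar>snd u - snd v\<bar>"
    using poly_lipschitz_markov[OF r(1), of B "snd u" "snd v"] r(2) sq B in_sq by simp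
  also have "\<dots> \<le> (real m)\<^sup>2 * B * dist u v"
    using dist_snd_le[of u v] \<open>B \<ge> 0\<close> by (intro mult_left_mono) (auto simp: dist_real_def)
  finally show ?thesis using 1 by linarith
qed

lemma compact_square: "compact square"
  unfolding square_def by (intro compact_Times) auto

lemma triangle_compact: "triangle t \<Longrightarrow> compact t"
  unfolding triangle_def simplex by (auto intro: finite_imp_compact_convex_hull)

text \<open>Three affinely independent points of the plane have a hull with interior, which contains
  a ball.\<close>

lemma triangle_measure_pos:
  assumes "triangle t" shows "measure lborel t > 0"
proof -
  obtain C where C: "\<not> affine_dependent C" "int (card C) = 3" "t = convex hull C"
    using assms unfolding triangle_def simplex_def by auto
  then have "interior t \<noteq> {}"
    using interior_convex_hull_eq_empty[of C] by simp
  then obtain c e where "e > 0" "ball c e \<subseteq> t"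
    using mem_interior by blast
  have fin: "emeasure lborel t < \<infinity>"
    using triangle_compact[OF assms] compact_imp_bounded emeasure_bounded_finite by blast
  have "0 < measure lborel (ball c e)" using content_ball_pos[OF \<open>e > 0\<close>] by simp
  also have "\<dots> \<le> measure lborel t"
    using \<open>ball c e \<subseteq> t\<close> triangle_compact[OF assms] fin
    by (intro measure_mono_fmeasurable) (auto simp: fmeasurable_def borel_compact)
  finally show ?thesis .
qed

section \<open>Averages over compact sets\<close>

definition average :: "plane set \<Rightarrow> (plane \<Rightarrow> real) \<Rightarrow> real" where
  "average t f = 1 / measure lborel t * (LINT z:t|lborel. f z)"

lemma set_integrable_compact:
  fixes f :: "'a::euclidean_space \<Rightarrow> real"
  assumes "compact t" "continuous_on t f" shows "set_integrable lborel t f"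
  unfolding set_integrable_def by (rule borel_integrable_compact[OF assms])

lemma average_add:
  assumes "compact t" "continuous_on t f" "continuous_on t g"
  shows "average t (\<lambda>z. f z + g z) = average t f + average t g"
  using assms by (simp add: average_def set_integrable_compact distrib_left add_divide_distrib)

lemma average_scale: "average t (\<lambda>z. a * f z) = a * average t f"
  by (simp add: average_def)

text \<open>With \<open>c\<close> the value of \<open>f\<close> at a point this compares the average
  with that value; with \<open>c = 0\<close> it bounds the average by a bound for
  \<open>f\<close>.\<close>

lemma average_close:
  assumes t: "compact t" "measure lborel t > 0" and f: "continuous_on t f"
    and close: "\<And>z. z \<in> t \<Longrightarrow> \<bar>f z - c\<bar> \<le> e"
  shows "\<bar>average t f - c\<bar> \<le> e"
proof -
  have const: "(LINT z:t|lborel. k) = measure lborel t * k" for k :: real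
    using t emeasure_bounded_finite[of t] compact_imp_bounded[of t]
    by (subst set_integral_const) (auto simp: borel_compact)
  have "(LINT z:t|lborel. f z) \<le> (LINT z:t|lborel. c + e)"
    using close t f by (intro set_integral_mono set_integrable_compact) (auto simp: abs_le_iff field_simps)
  moreover have "(LINT z:t|lborel. c - e) \<le> (LINT z:t|lborel. f z)"
    using close t f by (intro set_integral_mono set_integrable_compact) (auto simp: abs_le_iff field_simps)
  ultimately show ?thesis
    using t(2) unfolding const average_def abs_le_iff by (simp add: field_simps)
qed

section \<open>Lagrange bases and Lebesgue constants\<close>

lemma unisolvent_points_finite:
  assumes "unisolvent_points m X" shows "finite X" "card X = bipoly_dim m"
proof -
  show "card X = bipoly_dim m" using assms by (simp add: unisolvent_points_def)
  then show "finite X" by (intro card_ge_0_finite) (simp add: bipoly_dim_def)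
qed

lemma unisolvent_points_eq_zero:
  assumes "unisolvent_points m X" "p \<in> bipoly m" "\<And>x. x \<in> X \<Longrightarrow> p x = 0"
  shows "p = (\<lambda>_. 0)"
  using assms unfolding unisolvent_points_def by blast

text \<open>The definite description is usable once exactly one such polynomial is known: existence
  is interpolation, uniqueness is unisolvence applied to a difference.\<close>

lemma lagrange_point_correct:
  assumes X: "unisolvent_points m X" and "x \<in> X"
  shows "lagrange_point m X x \<in> bipoly m"
    "y \<in> X \<Longrightarrow> lagrange_point m X x y = (if x = y then 1 else 0)"
proof -
  note inj = unisolvent_points_eq_zero[OF X]
  obtain p where p: "p \<in> bipoly m" "\<forall>y\<in>X. p y = (if x = y then 1 else 0)"
    using bipoly_unisolvent_interpolation[of X m "\<lambda>x p. p x" "\<lambda>y. if x = y then 1 else 0"]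
      unisolvent_points_finite[OF X] inj by auto
  have "q = p" if "q \<in> bipoly m" "\<forall>y\<in>X. q y = (if x = y then 1 else 0)" for q
  proof -
    have "(\<lambda>z. q z - p z) = (\<lambda>_. 0)" using p that by (intro inj bipoly_diff) auto
    then show ?thesis by (auto simp: fun_eq_iff)
  qed
  then have "\<exists>!q. q \<in> bipoly m \<and> (\<forall>y\<in>X. q y = (if x = y then 1 else 0))"
    using p by (intro ex1I[of _ p]) blast+
  from theI'[OF this] have "lagrange_point m X x \<in> bipoly m \<and>
      (\<forall>y\<in>X. lagrange_point m X x y = (if x = y then 1 else 0))"
    unfolding lagrange_point_def .
  then show "lagrange_point m X x \<in> bipoly m"
    "y \<in> X \<Longrightarrow> lagrange_point m X x y = (if x = y then 1 else 0)" by auto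
qed

text \<open>A finite constant excludes the value \<infinity>, hence gives unisolvence; then
  \<open>p\<close> equals its Lagrange expansion, which is estimated term by term.\<close>

lemma lebesgue_const_points_bound:
  assumes L: "lebesgue_const_points \<Omega> m X \<le> ereal L"
  shows "unisolvent_points m X"
    and "\<lbrakk>p \<in> bipoly m; \<And>x. x \<in> X \<Longrightarrow> \<bar>p x\<bar> \<le> A; A \<ge> 0; \<xi> \<in> \<Omega>\<rbrakk> \<Longrightarrow> \<bar>p \<xi>\<bar> \<le> L * A"
proof -
  show X: "unisolvent_points m X"
    using L unfolding lebesgue_const_points_def by (auto split: if_splits)
  assume p: "p \<in> bipoly m" "\<And>x. x \<in> X \<Longrightarrow> \<bar>p x\<bar> \<le> A" and "A \<ge> 0" and \<xi>: "\<xi> \<in> \<Omega>"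
  have "ereal (\<Sum>x\<in>X. \<bar>lagrange_point m X x \<xi>\<bar>) \<le> ereal L"
    using L X \<xi> unfolding lebesgue_const_points_def by (auto simp: SUP_le_iff)
  then have sum_le: "(\<Sum>x\<in>X. \<bar>lagrange_point m X x \<xi>\<bar>) \<le> L" by simp
  have "(\<lambda>z. p z - (\<Sum>x\<in>X. p x * lagrange_point m X x z)) = (\<lambda>_. 0)"
  proof -
    have "(\<lambda>z. p z - (\<Sum>x\<in>X. p x * lagrange_point m X x z)) \<in> bipoly m"
      using p lagrange_point_correct(1)[OF X] by (intro bipoly_diff bipoly_sum) auto
    moreover have "p y - (\<Sum>x\<in>X. p x * lagrange_point m X x y) = 0" if "y \<in> X" for y
    proof -
      have "(\<Sum>x\<in>X. p x * lagrange_point m X x y) = (\<Sum>x\<in>X. if x = y then p x else 0)"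
        using lagrange_point_correct(2)[OF X] that by (intro sum.cong) auto
      then show ?thesis using that unisolvent_points_finite[OF X] by simp
    qed
    ultimately show ?thesis by (rule unisolvent_points_eq_zero[OF X])
  qed
  from fun_cong[OF this, of \<xi>] have "p \<xi> = (\<Sum>x\<in>X. p x * lagrange_point m X x \<xi>)" by simp
  also have "\<bar>\<dots>\<bar> \<le> (\<Sum>x\<in>X. A * \<bar>lagrange_point m X x \<xi>\<bar>)"
    by (rule sum_abs[THEN order_trans], rule sum_mono) (auto simp: abs_mult p(2) mult_right_mono)
  also have "\<dots> \<le> L * A"
    using mult_left_mono[OF sum_le \<open>A \<ge> 0\<close>] by (simp add: sum_distrib_left mult.commute)
  finally show "\<bar>p \<xi>\<bar> \<le> L * A" .
qed

text \<open>The sets are indexed by \<open>X\<close> because the assignment of triangles to points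
  is not yet known to be injective when this is applied.\<close>

lemma average_bipoly_interpolation:
  fixes \<tau> :: "'x \<Rightarrow> plane set"
  assumes "finite X" "card X = bipoly_dim m" "\<And>x. x \<in> X \<Longrightarrow> compact (\<tau> x)"
    and "\<And>p. p \<in> bipoly m \<Longrightarrow> (\<And>x. x \<in> X \<Longrightarrow> average (\<tau> x) p = 0) \<Longrightarrow> p = (\<lambda>_. 0)"
  shows "\<exists>p\<in>bipoly m. \<forall>x\<in>X. average (\<tau> x) p = d x"
  using assms
  by (intro bipoly_unisolvent_interpolation[where \<Lambda> = "\<lambda>x. average (\<tau> x)"])
    (auto intro: average_add continuous_on_bipoly average_scale)

lemma average_eq_zero_iff:
  assumes "triangle t" shows "average t p = 0 \<longleftrightarrow> (LINT z:t|lborel. p z) = 0"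
  using triangle_measure_pos[OF assms] by (simp add: average_def)

lemma unisolvent_triangles_finite:
  assumes "unisolvent_triangles m S" shows "finite S" "card S = bipoly_dim m"
proof -
  show "card S = bipoly_dim m" using assms by (simp add: unisolvent_triangles_def)
  then show "finite S" by (intro card_ge_0_finite) (simp add: bipoly_dim_def)
qed

lemma lagrange_triangle_correct:
  assumes S: "unisolvent_triangles m S" and tri: "\<And>t. t \<in> S \<Longrightarrow> triangle t" and "s \<in> S"
  shows "lagrange_triangle m S s \<in> bipoly m"
    "t \<in> S \<Longrightarrow> average t (lagrange_triangle m S s) = (if s = t then 1 else 0)"
proof -
  have inj: "p = (\<lambda>_. 0)" if "p \<in> bipoly m" "\<And>t. t \<in> S \<Longrightarrow> average t p = 0" for p
    using S that tri average_eq_zero_iff unfolding unisolvent_triangles_def by blast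
  obtain p where p: "p \<in> bipoly m" "\<forall>t\<in>S. average t p = (if s = t then 1 else 0)"
    using average_bipoly_interpolation[of S m "\<lambda>t. t" "\<lambda>t. if s = t then 1 else 0"]
      unisolvent_triangles_finite[OF S] inj tri triangle_compact by auto
  have "q = p" if q: "q \<in> bipoly m" "\<forall>t\<in>S. average t q = (if s = t then 1 else 0)" for q
  proof -
    \<comment> \<open>The difference is written as a sum with a multiple to match
      \<open>average_add\<close> and \<open>average_scale\<close>.\<close>
    have "average t (\<lambda>z. q z + (-1) * p z) = 0" if "t \<in> S" for t
    proof -
      have "average t (\<lambda>z. q z + (-1) * p z) = average t q + average t (\<lambda>z. (-1) * p z)"
        using p(1) q(1) tri[OF that] triangle_compact
        by (intro average_add continuous_on_bipoly[of _ m] bipoly_scale) auto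
      also have "\<dots> = average t q + (-1) * average t p" by (simp only: average_scale)
      also have "\<dots> = 0" using p(2) q(2) that by simp
      finally show ?thesis .
    qed
    then have "(\<lambda>z. q z + (-1) * p z) = (\<lambda>_. 0)"
      using p q by (intro inj bipoly_add bipoly_scale) auto
    then show ?thesis by (auto simp: fun_eq_iff)
  qed
  then have "\<exists>!q. q \<in> bipoly m \<and> (\<forall>t\<in>S. average t q = (if s = t then 1 else 0))"
    using p by (intro ex1I[of _ p]) blast+
  from theI'[OF this] have "lagrange_triangle m S s \<in> bipoly m \<and>
      (\<forall>t\<in>S. average t (lagrange_triangle m S s) = (if s = t then 1 else 0))"
    unfolding lagrange_triangle_def average_def .
  then show "lagrange_triangle m S s \<in> bipoly m"
    "t \<in> S \<Longrightarrow> average t (lagrange_triangle m S s) = (if s = t then 1 else 0)" by auto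
qed

lemma average_bipoly_sum:
  assumes "compact t" "\<And>i. i \<in> I \<Longrightarrow> p i \<in> bipoly m"
  shows "average t (\<lambda>z. \<Sum>i\<in>I. a i * p i z) = (\<Sum>i\<in>I. a i * average t (p i))"
  using assms(2)
proof (induction I rule: infinite_finite_induct)
  case (insert i I)
  have "average t (\<lambda>z. a i * p i z + (\<Sum>i\<in>I. a i * p i z))
      = average t (\<lambda>z. a i * p i z) + average t (\<lambda>z. \<Sum>i\<in>I. a i * p i z)"
    using insert.prems
    by (intro average_add assms(1) continuous_on_bipoly[of _ m] bipoly_scale bipoly_sum) auto
  then show ?case using insert by (simp add: average_scale)
qed (simp_all add: average_def)

text \<open>Duality: for fixed \<open>t\<close> a signed sum of the Lagrange basis has averages of
  modulus at most 1 over \<open>S\<close>, while its average over \<open>t\<close> is exactly the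
  quantity in the supremum.\<close>

lemma lebesgue_const_triangles_le:
  assumes S: "unisolvent_triangles m S" and tri: "\<And>t. t \<in> S \<Longrightarrow> triangle t"
    and bound: "\<And>p z. \<lbrakk>p \<in> bipoly m; \<And>s. s \<in> S \<Longrightarrow> \<bar>average s p\<bar> \<le> 1; z \<in> \<Omega>\<rbrakk> \<Longrightarrow> \<bar>p z\<bar> \<le> C"
  shows "lebesgue_const_triangles \<Omega> m S \<le> ereal C"
proof -
  let ?l = "lagrange_triangle m S"
  have "1 / measure lborel t * (\<Sum>s\<in>S. \<bar>LINT z:t|lborel. ?l s z\<bar>) \<le> C"
    if t: "triangle t" "t \<subseteq> \<Omega>" for t
  proof -
    \<comment> \<open>Where the integral is 0 the sign is 0, which still has modulus at most
      1.\<close>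
    define \<epsilon> where "\<epsilon> s = sgn (LINT z:t|lborel. ?l s z)" for s
    define p where "p z = (\<Sum>s\<in>S. \<epsilon> s * ?l s z)" for z
    have l: "?l s \<in> bipoly m" if "s \<in> S" for s using lagrange_triangle_correct(1)[OF S tri that] .
    have p: "p \<in> bipoly m" unfolding p_def using l by (rule bipoly_sum)
    have avg: "average t p = (\<Sum>s\<in>S. \<epsilon> s * average t (?l s))" if "compact t" for t
      unfolding p_def using that l by (rule average_bipoly_sum)
    have "\<bar>average s p\<bar> \<le> 1" if "s \<in> S" for s
    proof -
      have "average s p = (\<Sum>r\<in>S. if r = s then \<epsilon> r else 0)"
        unfolding avg[OF triangle_compact[OF tri[OF that]]]
        using lagrange_triangle_correct(2)[OF S tri] that by (intro sum.cong) auto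
      also have "\<dots> = \<epsilon> s" using that unisolvent_triangles_finite[OF S] by simp
      finally show ?thesis by (simp add: \<epsilon>_def sgn_real_def)
    qed
    then have "\<bar>p z - 0\<bar> \<le> C" if "z \<in> t" for z
      using bound[OF p] subsetD[OF t(2) that] by simp
    then have "\<bar>average t p - 0\<bar> \<le> C"
      using t p triangle_measure_pos triangle_compact
      by (intro average_close) (auto intro: continuous_on_bipoly)
    moreover have "average t p = 1 / measure lborel t * (\<Sum>s\<in>S. \<bar>LINT z:t|lborel. ?l s z\<bar>)"
    proof -
      have "average t p = (\<Sum>s\<in>S. \<epsilon> s * average t (?l s))"
        by (rule avg[OF triangle_compact[OF t(1)]])
      also have "\<dots> = (\<Sum>s\<in>S. 1 / measure lborel t * \<bar>LINT z:t|lborel. ?l s z\<bar>)"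
        by (intro sum.cong) (simp_all add: average_def \<epsilon>_def abs_sgn)
      finally show ?thesis by (simp only: sum_distrib_left)
    qed
    ultimately show ?thesis by simp
  qed
  then show ?thesis
    unfolding lebesgue_const_triangles_def using S by (auto intro!: SUP_least)
qed

text \<open>Taking \<open>B\<close> to be the maximum of \<open>\<bar>p\<bar>\<close> gives
  \<open>B \<le> L (A + 2 m\<^sup>2 h B) \<le> L A + \<alpha> B\<close>.\<close>

lemma average_stability:
  assumes L: "lebesgue_const_points square m X \<le> ereal L" and "L \<ge> 0"
    and \<tau>: "\<And>x. x \<in> X \<Longrightarrow> triangle (\<tau> x) \<and> x \<in> \<tau> x \<and> \<tau> x \<subseteq> square"
    and h: "\<And>x z. x \<in> X \<Longrightarrow> z \<in> \<tau> x \<Longrightarrow> dist z x \<le> h" and "h \<ge> 0"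
    and \<alpha>: "L * (2 * (real m)\<^sup>2 * h) \<le> \<alpha>" "\<alpha> < 1"
    and p: "p \<in> bipoly m" and A: "\<And>x. x \<in> X \<Longrightarrow> \<bar>average (\<tau> x) p\<bar> \<le> A" "A \<ge> 0"
    and z: "z \<in> square"
  shows "\<bar>p z\<bar> \<le> L * A / (1 - \<alpha>)"
proof -
  have "continuous_on square (\<lambda>z. \<bar>p z\<bar>)" using continuous_on_bipoly[OF p] by (intro continuous_intros)
  then obtain \<xi> where \<xi>: "\<xi> \<in> square" "\<And>z. z \<in> square \<Longrightarrow> \<bar>p z\<bar> \<le> \<bar>p \<xi>\<bar>"
    using continuous_attains_sup[OF compact_square] z by blast
  define B where "B = \<bar>p \<xi>\<bar>"
  have "\<bar>p x\<bar> \<le> A + 2 * (real m)\<^sup>2 * B * h" if x: "x \<in> X" for x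
  proof -
    have "\<bar>p z - p x\<bar> \<le> 2 * (real m)\<^sup>2 * B * h" if "z \<in> \<tau> x" for z
    proof -
      have "\<bar>p z - p x\<bar> \<le> 2 * (real m)\<^sup>2 * B * dist z x"
        using \<tau>[OF x] that \<xi> by (intro bipoly_lipschitz_square[OF p]) (auto simp: B_def)
      also have "\<dots> \<le> 2 * (real m)\<^sup>2 * B * h"
        using h[OF x that] by (intro mult_left_mono) (auto simp: B_def)
      finally show ?thesis .
    qed
    then have "\<bar>average (\<tau> x) p - p x\<bar> \<le> 2 * (real m)\<^sup>2 * B * h"
      using \<tau>[OF x] triangle_measure_pos triangle_compact continuous_on_bipoly[OF p]
      by (intro average_close) auto
    then show ?thesis using A(1)[OF x] by linarith
  qed
  then have "B \<le> L * (A + 2 * (real m)\<^sup>2 * B * h)"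
    unfolding B_def using \<xi> \<open>h \<ge> 0\<close> A by (intro lebesgue_const_points_bound(2)[OF L p]) auto
  also have "\<dots> = L * A + (L * (2 * (real m)\<^sup>2 * h)) * B" by (simp add: algebra_simps)
  also have "\<dots> \<le> L * A + \<alpha> * B"
    using \<alpha> by (intro add_left_mono mult_right_mono) (auto simp: B_def)
  finally have "B \<le> L * A / (1 - \<alpha>)" using \<alpha>(2) by (simp add: field_simps)
  then show ?thesis using \<xi>(2)[OF z] by (simp add: B_def)
qed

text \<open>A perturbation argument: each point evaluation is replaced by the average over a small
  triangle containing the point, at the cost of the factor 1 / (1 - \<alpha>).\<close>

lemma lebesgue_const_triangles_near_points:
  assumes L: "lebesgue_const_points square m X \<le> ereal L" and "L \<ge> 0" and X: "X \<subseteq> square"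
    and \<tau>: "\<And>x. x \<in> X \<Longrightarrow> triangle (\<tau> x) \<and> x \<in> \<tau> x \<and> \<tau> x \<subseteq> square"
    and h: "\<And>x z. x \<in> X \<Longrightarrow> z \<in> \<tau> x \<Longrightarrow> dist z x \<le> h" and "h \<ge> 0"
    and \<alpha>: "L * (2 * (real m)\<^sup>2 * h) \<le> \<alpha>" "\<alpha> < 1"
  shows "lebesgue_const_triangles square m (\<tau> ` X) \<le> ereal (L / (1 - \<alpha>))"
proof -
  have uX: "unisolvent_points m X" by (rule lebesgue_const_points_bound(1)[OF L])
  note stab = average_stability[OF L \<open>L \<ge> 0\<close> \<tau> h \<open>h \<ge> 0\<close> \<alpha>]
  have inj: "p = (\<lambda>_. 0)" if p: "p \<in> bipoly m" and 0: "\<And>x. x \<in> X \<Longrightarrow> average (\<tau> x) p = 0" for p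
  proof -
    \<comment> \<open>Stability with A = 0, evaluated at the points of \<open>X\<close>, reduces the
      claim to unisolvence of \<open>X\<close>.\<close>
    have "\<bar>p x\<bar> \<le> L * 0 / (1 - \<alpha>)" if "x \<in> X" for x
      using that X 0 by (intro stab p) auto
    then show ?thesis by (intro unisolvent_points_eq_zero[OF uX p]) simp
  qed
  \<comment> \<open>Distinct points get distinct triangles, since the averages can be prescribed freely.\<close>
  have "inj_on \<tau> X"
  proof (rule inj_onI, rule ccontr)
    fix x y assume xy: "x \<in> X" "y \<in> X" "\<tau> x = \<tau> y" "x \<noteq> y"
    obtain p where "\<forall>u\<in>X. average (\<tau> u) p = (if u = x then 1 else 0)"
      using average_bipoly_interpolation[of X m \<tau> "\<lambda>u. if u = x then 1 else 0"]
        unisolvent_points_finite[OF uX] inj \<tau> triangle_compact by auto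
    then show False using xy by (metis zero_neq_one)
  qed
  then have "card (\<tau> ` X) = bipoly_dim m"
    using unisolvent_points_finite[OF uX] by (simp add: card_image)
  moreover have "p = (\<lambda>_. 0)" if "p \<in> bipoly m" "\<forall>t\<in>\<tau> ` X. (LINT z:t|lborel. p z) = 0" for p
    using that \<tau> average_eq_zero_iff by (intro inj) auto
  ultimately have "unisolvent_triangles m (\<tau> ` X)"
    unfolding unisolvent_triangles_def by blast
  then show ?thesis
  proof (rule lebesgue_const_triangles_le)
    fix p z assume "p \<in> bipoly m" "\<And>s. s \<in> \<tau> ` X \<Longrightarrow> \<bar>average s p\<bar> \<le> 1" "z \<in> square"
    then show "\<bar>p z\<bar> \<le> L / (1 - \<alpha>)" using stab[of p 1 z] by simp
  qed (use \<tau> in auto)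
qed

section \<open>Padua points, mesh size and the final estimate\<close>

lemma padua_points_subset_square: "padua_points m \<subseteq> square"
proof -
  have "\<bar>(-1) ^ k * cos t\<bar> \<le> 1" for k :: nat and t :: real
    by (simp add: abs_mult power_abs)
  then show ?thesis by (auto simp: padua_points_def square_def abs_le_iff minus_le_iff)
qed

lemma first_triangle_correct:
  assumes "x \<in> \<Union> (set T)" shows "first_triangle T x \<in> set T" "x \<in> first_triangle T x"
proof -
  have "\<exists>i. i < length T \<and> x \<in> T ! i" using assms by (auto simp: in_set_conv_nth)
  then have "(LEAST i. i < length T \<and> x \<in> T ! i) < length T \<and>
      x \<in> T ! (LEAST i. i < length T \<and> x \<in> T ! i)"
    by (rule LeastI_ex)
  then show "first_triangle T x \<in> set T" "x \<in> first_triangle T x"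
    by (auto simp: first_triangle_def)
qed

text \<open>The largest distance within a simplex is attained at vertices. Finiteness of the set of
  edge lengths makes its \<open>Max\<close> an upper bound.\<close>

lemma triangle_diameter_le_h_max:
  assumes tri: "\<And>t. t \<in> set T \<Longrightarrow> triangle t" and "t \<in> set T" "x \<in> t" "y \<in> t"
  shows "dist x y \<le> h_max T"
proof -
  let ?E = "{dist a b | a b t. t \<in> set T \<and> a extreme_point_of t \<and> b extreme_point_of t \<and> a \<noteq> b}"
  have "finite {a. a extreme_point_of t}" if "t \<in> set T" for t
    using tri[OF that] unfolding triangle_def simplex
    by (auto intro: finite_subset dest: extreme_point_of_convex_hull)
  then have "finite (\<Union>t\<in>set T. (\<lambda>(a, b). dist a b) ` ({a. a extreme_point_of t} \<times> {a. a extreme_point_of t}))"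
    by blast
  then have fin: "finite ?E" by (rule finite_subset[rotated]) auto
  obtain C where C: "\<not> affine_dependent C" "int (card C) = 3" "t = convex hull C"
    using tri[OF assms(2)] unfolding triangle_def simplex_def by auto
  have vertices: "dist u v \<le> h_max T" if "u \<in> C" "v \<in> C" "u \<noteq> v" for u v
  proof -
    have "u extreme_point_of t" "v extreme_point_of t"
      using that C extreme_point_of_convex_hull_affine_independent[OF C(1)] by auto
    then have "dist u v \<in> ?E" using that assms(2) by blast
    then show ?thesis unfolding h_max_def using fin by (rule Max_ge[rotated])
  qed
  \<comment> \<open>Two distinct vertices show that \<open>h_max T\<close> is nonnegative, which
    settles the case where the extremal vertices \<open>u\<close> and \<open>v\<close>
    coincide.\<close>
  obtain a b where "a \<in> C" "b \<in> C" "a \<noteq> b"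
  proof -
    have "Suc 0 < card C" using C(2) by simp
    then show ?thesis using that by (metis One_nat_def card_le_Suc0_iff_eq card.infinite not_less not_less_zero)
  qed
  then have "0 \<le> h_max T" using vertices[of a b] zero_le_dist[of a b] by linarith
  moreover have "finite C" using C(2) by (intro card_ge_0_finite) simp
  then obtain u v where "u \<in> C" "v \<in> C" "norm (x - y) \<le> norm (u - v)"
    using simplex_extremal_le_exists assms(3,4) unfolding C(3) by blast
  ultimately show ?thesis
    using vertices[of u v] by (cases "u = v") (auto simp: dist_norm)
qed

theorem proposition5:
  fixes m :: nat and K \<alpha> :: real and T :: "plane set list"
  assumes "m \<ge> 2"
    and "K > 0"
    and "\<And>k :: nat. k \<ge> 2 \<Longrightarrow>
           lebesgue_const_points square k (padua_points k) \<le> ereal (K * (ln (real k))\<^sup>2)"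
    and "0 < \<alpha>" and "\<alpha> < 1"
    and "triangulation_of square T"
    and "h_max T < min (\<alpha> / (2 * K * (real m * ln (real m))\<^sup>2))
                       (sqrt 2 * (1 - cos (pi / real (m + 1))))"
  shows "lebesgue_const_triangles square m (padua_triangles m T)
           \<le> ereal (K / (1 - \<alpha>) * (ln (real m))\<^sup>2)"
proof -
  define L where "L = K * (ln (real m))\<^sup>2"
  have tri: "triangle t" if "t \<in> set T" for t
    using assms(6) that unfolding triangulation_of_def by blast
  have cover: "\<Union> (set T) = square" using assms(6) unfolding triangulation_of_def by blast
  have first: "first_triangle T x \<in> set T" "x \<in> first_triangle T x" if "x \<in> padua_points m" for x
    using first_triangle_correct[of x T] that padua_points_subset_square cover by blast+
  \<comment> \<open>Here m \<ge> 2 matters: it makes ln m nonzero.\<close>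
  have pos: "0 < 2 * K * (real m * ln (real m))\<^sup>2" using assms(1,2) by simp
  \<comment> \<open>The triangle covering the origin has nonnegative diameter, which is at most
    \<open>h_max T\<close>.\<close>
  have "0 \<le> h_max T"
  proof -
    have "(0, 0) \<in> \<Union> (set T)" unfolding cover by (simp add: square_def)
    then obtain t where "t \<in> set T" "(0, 0) \<in> t" by blast
    then show ?thesis using triangle_diameter_le_h_max[of T t "(0, 0)" "(0, 0)"] tri by simp
  qed
  have "lebesgue_const_triangles square m (first_triangle T ` padua_points m) \<le> ereal (L / (1 - \<alpha>))"
  proof (rule lebesgue_const_triangles_near_points)
    show "lebesgue_const_points square m (padua_points m) \<le> ereal L"
      unfolding L_def using assms(1,3) by blast
    \<comment> \<open>Since 2 K (m ln m)^2 = 2 m^2 L, this is the first bound on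
      \<open>h_max T\<close> cleared of its denominator.\<close>
    show "L * (2 * (real m)\<^sup>2 * h_max T) \<le> \<alpha>"
    proof -
      have "h_max T * (2 * K * (real m * ln (real m))\<^sup>2) < \<alpha>"
        using assms(7) pos by (simp add: pos_less_divide_eq)
      then show ?thesis by (simp add: L_def power_mult_distrib mult_ac)
    qed
    show "dist z x \<le> h_max T" if "x \<in> padua_points m" "z \<in> first_triangle T x" for x z
      using triangle_diameter_le_h_max[of T "first_triangle T x" z x] tri first[OF that(1)] that(2) by simp
    show "triangle (first_triangle T x) \<and> x \<in> first_triangle T x \<and> first_triangle T x \<subseteq> square"
      if "x \<in> padua_points m" for x
      using first[OF that] tri cover by blast
  qed (use assms \<open>0 \<le> h_max T\<close> padua_points_subset_square in \<open>auto simp: L_def\<close>)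
  then show ?thesis by (simp add: padua_triangles_def L_def)
qed

end
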